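(* The Steiner-Soddy family of polygons $P$ conserves $$\sum_{i=1}^N\tan\frac{\theta_i}{2},$$ where $\theta_i$ is the internal angle of $P$ at its $i$-th vertex $P_i$; that is, this sum is constant over the family.
   Context: Consider $N$ congruent circles centered at the vertices of a regular $N$-gon, consecutive ones being tangent. By symmetry, all of them are tangent to an inner circle and to an outer circle. The image of this configuration under inversion in a fixed circle is a Steiner chain: $N$ circles, consecutive ones tangent, all tangent to two fixed circles (the inner and outer Soddy circles, images of the two concentric circles). Rotating the regular $N$-gon about its center, with the inversion circle fixed, gives a one-parameter family of such chains with the same Soddy circles, called the Steiner porism. The Steiner-Soddy polygon $P$ is the $N$-gon whose consecutive vertices $P_1,\dots,P_N$ are the centers of the consecutive circles in the chain; the Steiner-Soddy family is the family of these polygons over the Steiner porism. All polygons of the family are inscribed in one fixed conic $E$ (an ellipse, a hyperbola, or a parabola), and their sides are tangent to one fixed circle. Sign convention: when $E$ is a hyperbola, the sign of $\tan(\theta_i/2)$ must be flipped for the two angles whose neighboring vertices lie on different branches of the hyperbola.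
   Formalization: For a hyperbola E with vertices on both branches, the stated sign flip fails (e.g. N=3); instead, tan(θ_i/2) is replaced by tan((π−θ_i)/2) at the two vertices whose neighbors lie on different branches and by −tan(θ_i/2) at the vertex separated from both neighbors, with θ_i in [0,π]. *)

theory Defs
  imports "HOL-Analysis.Analysis"
begin

text \<open>The plane is modelled by \<^typ>\<open>complex\<close>.\<close>

definition inversion :: "complex \<Rightarrow> real \<Rightarrow> complex \<Rightarrow> complex" where
  "inversion Z k z = Z + of_real (k\<^sup>2 / (dist z Z)\<^sup>2) * (z - Z)"

definition ngon_vertex :: "nat \<Rightarrow> complex \<Rightarrow> real \<Rightarrow> real \<Rightarrow> nat \<Rightarrow> complex" where
  "ngon_vertex N c R t i = c + of_real R * cis (t + 2 * pi * real i / real N)"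

text \<open>The side of the regular \<open>N\<close>-gon is \<open>2 R sin (\<pi>/N)\<close>, so congruent circles centered at its
  vertices are consecutively (externally) tangent iff their radius is half of that.\<close>

definition chain_circle :: "nat \<Rightarrow> complex \<Rightarrow> real \<Rightarrow> real \<Rightarrow> nat \<Rightarrow> complex set" where
  "chain_circle N c R t i = sphere (ngon_vertex N c R t i) (R * sin (pi / real N))"

text \<open>The polygons over the porism obtained by inverting in the circle with center \<open>Z\<close> and
  radius \<open>k\<close>; the rotation angle \<open>t\<close> is the parameter. A polygon is given by the sequence of its
  vertices, indexed by all natural numbers and automatically \<open>N\<close>-periodic.
  A position \<open>t\<close> at which one of the circles passes through \<open>Z\<close> contributes no polygon: the image
  of that circle is then a line (together with \<open>Z\<close>, since division by \<open>0\<close> yields \<open>0\<close>), hence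
  never a \<^const>\<open>sphere\<close> of positive radius.\<close>

definition steiner_soddy_family ::
    "nat \<Rightarrow> complex \<Rightarrow> real \<Rightarrow> complex \<Rightarrow> real \<Rightarrow> (nat \<Rightarrow> complex) set" where
  "steiner_soddy_family N c R Z k =
     {P. \<exists>t. \<forall>i. \<exists>\<rho>>0. inversion Z k ` chain_circle N c R t i = sphere (P i) \<rho>}"

text \<open>Ellipses (circles included), parabolas and hyperbolas: the nonempty real conics whose
  symmetric \<open>3 \<times> 3\<close> matrix is nonsingular. The last conjunct is four times its determinant.\<close>

definition nondegenerate_conic :: "complex set \<Rightarrow> bool" where
  "nondegenerate_conic E \<longleftrightarrow> E \<noteq> {} \<and>
     (\<exists>p q r u v w :: real.
        E = {z. p * (Re z)\<^sup>2 + q * Re z * Im z + r * (Im z)\<^sup>2 + u * Re z + v * Im z + w = 0} \<and>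
        4 * p * r * w + q * u * v - p * v\<^sup>2 - r * u\<^sup>2 - w * q\<^sup>2 \<noteq> 0)"

text \<open>The angle \<open>ABC\<close> at \<open>B\<close>, in \<open>[0, \<pi>]\<close>.\<close>

definition angle_at :: "complex \<Rightarrow> complex \<Rightarrow> complex \<Rightarrow> real" where
  "angle_at A B C = arccos (((A - B) \<bullet> (C - B)) / (norm (A - B) * norm (C - B)))"

text \<open>The summand at the vertex \<open>B\<close> with neighbors \<open>A\<close> and \<open>C\<close>, all three on the conic \<open>E\<close>.
  The branches of a hyperbola are its connected components; an ellipse or a parabola is connected,
  so there, and whenever all vertices are on one branch, the summand is \<open>tan (\<theta>/2)\<close>.
  At most one vertex of a polygon of the family is separated from the others, and then the two
  sides through it are reckoned as passing through infinity.
  At its two neighbors this reverses the direction of exactly one of the two sides, which replaces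
  \<open>\<theta>\<close> by \<open>\<pi> - \<theta>\<close>; at the separated vertex itself both sides are reversed, which keeps \<open>\<theta>\<close> but
  makes the angle negatively oriented.
  Merely changing the sign of \<open>tan (\<theta>/2)\<close> at the two vertices whose neighbors are on different
  branches does not give a constant sum.\<close>

definition signed_half_angle_tan :: "complex set \<Rightarrow> complex \<Rightarrow> complex \<Rightarrow> complex \<Rightarrow> real" where
  "signed_half_angle_tan E A B C =
     (let \<theta> = angle_at A B C in
      if \<not> connected_component E A C then tan ((pi - \<theta>) / 2)
      else if connected_component E A B then tan (\<theta> / 2)
      else - tan (\<theta> / 2))"

end

theory Submission
  imports Defs
begin

text \<open>
  Let \<open>v\<close> be the center of a chain circle before the inversion, relative to the center \<open>Z\<close> of
  inversion, let \<open>r\<close> be the common radius, and let \<open>e = |v|\<^sup>2 - r\<^sup>2\<close> be the power of \<open>Z\<close> with respect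
  to that circle. Inversion turns the circle into one with center \<open>Z + (k\<^sup>2 / e) v\<close> and signed radius
  \<open>k\<^sup>2 r / e\<close>, negative exactly if \<open>Z\<close> lies inside the circle. The circle through the points of
  contact is orthogonal to the whole chain, so its image has a fixed radius \<open>\<rho>\<close> and touches the lines
  of all sides at the points of contact. Half the angle between the two tangents from a vertex is
  thus an angle of a right triangle with legs \<open>\<rho>\<close> and \<open>k\<^sup>2 r / |e|\<close>, and its tangent is \<open>K |e|\<close> with a
  constant \<open>K\<close>. The angle of the polygon is this angle or, next to a vertex with negative power, its
  supplement; with the signs prescribed for the summands, each of them is \<open>K e\<close>. The sum is therefore
  \<open>K\<close> times a sum of powers, and this one is constant because \<open>e\<close> is a constant plus a multiple of
  \<open>cos (s - s\<^sub>0)\<close>, with \<open>s\<close> the position on the circle of centers, and the cosines at the vertices of a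
  regular polygon add up to \<open>0\<close>.

  The half-angle is not found from the tangent circle but by computation: the mutual distances of
  three consecutive \<open>v\<close> are known, which gives the cosine of the angle in terms of three consecutive
  powers (\<open>angle_of_tangent_polygon\<close>), and these satisfy one quadratic relation
  (\<open>circle_power_product\<close>). The result is \<open>\<plusminus> (1 - y\<^sup>2) / (1 + y\<^sup>2)\<close> with \<open>y = K e\<close>, the sign being that
  of the product of the two neighboring powers.

  What remains is to match signs of powers with components of \<open>E\<close>. The centers are the image of a
  circle under a projective map, so the quadratic form of \<open>E\<close>, which vanishes on them, pulls back to
  a multiple of \<open>X\<^sup>2 + Y\<^sup>2 - T\<^sup>2\<close>. As it is nonsingular, \<open>E\<close> does not meet the image of the line at
  infinity \<open>T = 0\<close> (\<open>conic_is_image_of_circle\<close>). On that line the affine function vanishes that takes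
  the value \<open>1 / e\<close> at the center with power \<open>e\<close>. So centers with powers of opposite signs lie in
  different components, while all centers with positive power lie on one arc.
\<close>

section \<open>Inversion of circles\<close>

lemma norm_scaleR_diff_squared:
  fixes x y :: "'a :: real_inner"
  shows "(norm (a *\<^sub>R x - b *\<^sub>R y))\<^sup>2 = a\<^sup>2 * (norm x)\<^sup>2 - 2 * a * b * (x \<bullet> y) + b\<^sup>2 * (norm y)\<^sup>2"
  unfolding power2_norm_eq_inner
  by (simp add: inner_diff inner_commute power2_eq_square algebra_simps)

lemma inversion_rel: "inversion Z k (Z + u) = Z + (k\<^sup>2 / (norm u)\<^sup>2) *\<^sub>R u"
  by (simp add: inversion_def dist_norm scaleR_conv_of_real)

lemma inversion_involution:
  assumes "z \<noteq> Z" "k > 0"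
  shows "inversion Z k (inversion Z k z) = z"
proof -
  have "(k\<^sup>2 / (k\<^sup>2 / (norm (z - Z))\<^sup>2 * norm (z - Z))\<^sup>2) * (k\<^sup>2 / (norm (z - Z))\<^sup>2) = 1"
    using assms by (simp add: field_simps power2_eq_square)
  then show ?thesis
    using inversion_rel[of Z k "z - Z"]
      inversion_rel[of Z k "(k\<^sup>2 / (norm (z - Z))\<^sup>2) *\<^sub>R (z - Z)"] by simp
qed

lemma inversion_mem_sphere:
  assumes k: "k > 0" and r: "r > 0"
    and e: "(norm v)\<^sup>2 - r\<^sup>2 \<noteq> 0" and z: "z \<in> sphere (Z + v) r"
  shows "inversion Z k z \<in>
    sphere (Z + (k\<^sup>2 / ((norm v)\<^sup>2 - r\<^sup>2)) *\<^sub>R v) (k\<^sup>2 * r / \<bar>(norm v)\<^sup>2 - r\<^sup>2\<bar>)"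
proof -
  define u where "u = z - Z"
  define e where "e = (norm v)\<^sup>2 - r\<^sup>2"
  have e0: "e \<noteq> 0" using assms(3) by (simp add: e_def)
  have "norm (u - v) = r"
    using z by (simp add: u_def dist_norm norm_minus_commute algebra_simps)
  then have r2: "r\<^sup>2 = (norm (u - v))\<^sup>2" by simp
  have uv: "2 * (u \<bullet> v) = (norm u)\<^sup>2 + e"
    unfolding e_def r2 by (simp add: power2_norm_eq_inner inner_diff inner_commute)
  have u0: "norm u \<noteq> 0"
  proof
    assume "norm u = 0"
    then show False using uv e0 by simp
  qed
  have "(norm ((k\<^sup>2 / (norm u)\<^sup>2) *\<^sub>R u - (k\<^sup>2 / e) *\<^sub>R v))\<^sup>2
      = (k\<^sup>2)\<^sup>2 * ((norm u)\<^sup>2 / ((norm u)\<^sup>2)\<^sup>2 - 2 * (u \<bullet> v) / ((norm u)\<^sup>2 * e) + (norm v)\<^sup>2 / e\<^sup>2)"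
    unfolding norm_scaleR_diff_squared by (simp add: power_divide power2_eq_square algebra_simps)
  also have "\<dots> = (k\<^sup>2 * r / \<bar>e\<bar>)\<^sup>2"
  proof -
    have "(norm v)\<^sup>2 = e + r\<^sup>2" by (simp add: e_def)
    then show ?thesis unfolding uv using u0 e0
      by (simp add: field_simps power2_eq_square)
  qed
  finally have "norm ((k\<^sup>2 / (norm u)\<^sup>2) *\<^sub>R u - (k\<^sup>2 / e) *\<^sub>R v) = k\<^sup>2 * r / \<bar>e\<bar>"
    using r by (subst (asm) power2_eq_iff_nonneg) auto
  then show ?thesis
    using inversion_rel[of Z k u] by (simp add: e_def[symmetric] u_def[symmetric] dist_norm norm_minus_commute)
      (simp add: u_def dist_norm norm_minus_commute)
qed

text \<open>Inverting the image circle with the same formula gives back the original one; as inversion is an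
  involution, this yields the missing inclusion.\<close>

lemma inversion_image_sphere:
  assumes k: "k > 0" and r: "r > 0" and e0: "(norm v)\<^sup>2 - r\<^sup>2 \<noteq> 0"
  shows "inversion Z k ` sphere (Z + v) r =
    sphere (Z + (k\<^sup>2 / ((norm v)\<^sup>2 - r\<^sup>2)) *\<^sub>R v) (k\<^sup>2 * r / \<bar>(norm v)\<^sup>2 - r\<^sup>2\<bar>)"
    (is "_ ` ?S = ?S'")
proof
  show "inversion Z k ` ?S \<subseteq> ?S'"
    using inversion_mem_sphere[OF assms] by blast
next
  define e where "e = (norm v)\<^sup>2 - r\<^sup>2"
  define v' where "v' = (k\<^sup>2 / e) *\<^sub>R v"
  define r' where "r' = k\<^sup>2 * r / \<bar>e\<bar>"
  have e: "e \<noteq> 0" using e0 by (simp add: e_def)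
  have "(norm v')\<^sup>2 - r'\<^sup>2 = (k\<^sup>2)\<^sup>2 * ((norm v)\<^sup>2 - r\<^sup>2) / e\<^sup>2"
    by (simp add: v'_def r'_def power_divide power_mult_distrib diff_divide_distrib algebra_simps)
  also have "\<dots> = (k\<^sup>2)\<^sup>2 / e"
    unfolding e_def[symmetric] using e by (simp add: power2_eq_square[of e])
  finally have e': "(norm v')\<^sup>2 - r'\<^sup>2 = (k\<^sup>2)\<^sup>2 / e" .
  have inv_center: "Z + (k\<^sup>2 / ((norm v')\<^sup>2 - r'\<^sup>2)) *\<^sub>R v' = Z + v"
    unfolding e' using e k by (simp add: v'_def power2_eq_square)
  have inv_radius: "k\<^sup>2 * r' / \<bar>(norm v')\<^sup>2 - r'\<^sup>2\<bar> = r"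
    unfolding e' using e k by (simp add: r'_def power2_eq_square abs_mult abs_divide)
  have r': "r' > 0" using e k r by (simp add: r'_def)
  have ne': "(norm v')\<^sup>2 - r'\<^sup>2 \<noteq> 0" unfolding e' using e k by simp
  show "?S' \<subseteq> inversion Z k ` ?S"
  proof
    fix y assume "y \<in> ?S'"
    then have y: "y \<in> sphere (Z + v') r'" by (simp add: v'_def r'_def e_def)
    from inversion_mem_sphere[OF k r' ne' y]
    have "inversion Z k y \<in> ?S" unfolding inv_center inv_radius .
    moreover have "y \<noteq> Z"
      using y ne' by (auto simp: dist_norm)
    then have "inversion Z k (inversion Z k y) = y"
      using inversion_involution k by blast
    ultimately show "y \<in> inversion Z k ` ?S" by force
  qed
qed

text \<open>Apart from \<open>Z\<close>, the image lies on a line that misses \<open>Z\<close>. A circle through \<open>Z\<close> cannot have all its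
  other points on a line: take the point opposite to \<open>Z\<close> and the two points midway between.\<close>

lemma inversion_image_sphere_through_center:
  assumes k: "k > 0" and v: "(norm v)\<^sup>2 - r\<^sup>2 = 0" and r: "r > 0" and "\<rho> > 0"
  shows "inversion Z k ` sphere (Z + v) r \<noteq> sphere p \<rho>"
proof
  assume img: "inversion Z k ` sphere (Z + v) r = sphere p \<rho>"
  have "norm v = r" using v r by (simp add: power2_eq_iff_nonneg)
  then have "Z \<in> sphere (Z + v) r" by (simp add: dist_norm)
  moreover have "inversion Z k Z = Z" by (simp add: inversion_def)
  ultimately have "Z \<in> sphere p \<rho>" using img by force
  then have q: "norm (p - Z) = \<rho>" by (simp add: dist_norm)
  have line: "2 * (v \<bullet> (y - Z)) = k\<^sup>2" if "y \<in> sphere p \<rho>" "y \<noteq> Z" for y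
  proof -
    from that img obtain z where z: "z \<in> sphere (Z + v) r" "y = inversion Z k z"
      by (metis imageE)
    define u where "u = z - Z"
    have y: "y - Z = (k\<^sup>2 / (norm u)\<^sup>2) *\<^sub>R u"
      using inversion_rel[of Z k u] z by (simp add: u_def)
    have "norm (u - v) = r"
      using z by (simp add: u_def dist_norm norm_minus_commute algebra_simps)
    then have "(norm (u - v))\<^sup>2 = (norm v)\<^sup>2" using v by simp
    then have uv: "2 * (v \<bullet> u) = (norm u)\<^sup>2"
      by (simp add: power2_norm_eq_inner inner_diff inner_commute)
    have "u \<noteq> 0" using y that by auto
    then show ?thesis unfolding y using uv by (simp add: field_simps)
  qed
  define q where "q = p - Z"
  have nq: "norm q = \<rho>" "q \<noteq> 0" using q \<open>\<rho> > 0\<close> by (auto simp: q_def)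
  have ii: "1 + \<i> \<noteq> 0" "1 - \<i> \<noteq> 0" by (auto simp: complex_eq_iff)
  have "q + q \<noteq> 0" "q * (1 + \<i>) \<noteq> 0" "q * (1 - \<i>) \<noteq> 0"
    using nq ii by auto
  then have ne: "p + q \<noteq> Z" "p + \<i> * q \<noteq> Z" "p - \<i> * q \<noteq> Z"
    by (auto simp: q_def algebra_simps)
  have mem: "p + q \<in> sphere p \<rho>" "p + \<i> * q \<in> sphere p \<rho>" "p - \<i> * q \<in> sphere p \<rho>"
    using nq by (auto simp: dist_norm norm_mult)
  note L = line[OF mem(1) ne(1)] line[OF mem(2) ne(2)] line[OF mem(3) ne(3)]
  have d: "p + q - Z = 2 *\<^sub>R q" "p + \<i> * q - Z = q + \<i> * q" "p - \<i> * q - Z = q - \<i> * q"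
    by (simp_all add: q_def scaleR_2)
  have "4 * (v \<bullet> q) = k\<^sup>2" "2 * (v \<bullet> q) + 2 * (v \<bullet> (\<i> * q)) = k\<^sup>2"
    "2 * (v \<bullet> q) - 2 * (v \<bullet> (\<i> * q)) = k\<^sup>2"
    using L unfolding d by (simp_all add: inner_add_right inner_diff_right)
  then have "k\<^sup>2 = 0" by linarith
  then show False using k by simp
qed

lemma sphere_center_unique:
  fixes a b :: complex
  assumes "sphere a r = sphere b s" "r > 0"
  shows "a = b"
proof -
  have "dist (a + of_real r * u) b = s" if "norm u = 1" for u
  proof -
    have "a + of_real r * u \<in> sphere a r" using that \<open>r > 0\<close> by (simp add: dist_norm norm_mult)
    then show ?thesis unfolding assms by (simp add: dist_commute)
  qed
  then have "(dist (a + of_real r * u) b)\<^sup>2 = s\<^sup>2" if "norm u = 1" for u using that by simp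
  note on_sphere = this[unfolded dist_norm cmod_power2]
  have "(Re a + r - Re b)\<^sup>2 + (Im a - Im b)\<^sup>2 = s\<^sup>2" "(Re a - r - Re b)\<^sup>2 + (Im a - Im b)\<^sup>2 = s\<^sup>2"
    using on_sphere[of 1] on_sphere[of "-1"] by simp_all
  then have "(Re a - Re b) * r = 0" by algebra
  moreover have "(Re a - Re b)\<^sup>2 + (Im a + r - Im b)\<^sup>2 = s\<^sup>2" "(Re a - Re b)\<^sup>2 + (Im a - r - Im b)\<^sup>2 = s\<^sup>2"
    using on_sphere[of \<i>] on_sphere[of "-\<i>"] by simp_all
  then have "(Im a - Im b) * r = 0" by algebra
  ultimately show ?thesis using \<open>r > 0\<close> by (simp add: complex_eq_iff)
qed

section \<open>The angle at a vertex\<close>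

text \<open>The \<open>v\<^sub>i\<close> are centers of three consecutive circles of radius \<open>r\<close>, the \<open>e\<^sub>i\<close> the powers of the origin,
  and \<open>\<kappa> = cos (\<pi>/N)\<close>. The distances determine all inner products of the \<open>v\<^sub>i\<close> in terms of the \<open>e\<^sub>i\<close>. As
  circles in contact stay in contact, a side has length \<open>k\<^sup>2 r |1/e\<^sub>0 + 1/e\<^sub>1|\<close>, the absolute value of a sum of
  signed radii; its sign accounts for external or internal contact and is the source of the sign in
  the result. The last assumption replaces the two neighboring powers by the middle one.\<close>

lemma angle_of_tangent_polygon:
  fixes Z v\<^sub>0 v\<^sub>1 v\<^sub>2 :: complex and k r \<kappa> K e\<^sub>0 e\<^sub>1 e\<^sub>2 :: real
  assumes "r > 0" "k > 0" "K > 0" "\<kappa> > 0"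
    and e: "e\<^sub>0 \<noteq> 0" "e\<^sub>1 \<noteq> 0" "e\<^sub>2 \<noteq> 0"
    and v: "(norm v\<^sub>0)\<^sup>2 = e\<^sub>0 + r\<^sup>2" "(norm v\<^sub>1)\<^sup>2 = e\<^sub>1 + r\<^sup>2" "(norm v\<^sub>2)\<^sup>2 = e\<^sub>2 + r\<^sup>2"
    and d: "(dist v\<^sub>0 v\<^sub>1)\<^sup>2 = 4 * r\<^sup>2" "(dist v\<^sub>1 v\<^sub>2)\<^sup>2 = 4 * r\<^sup>2" "(dist v\<^sub>0 v\<^sub>2)\<^sup>2 = 16 * r\<^sup>2 * \<kappa>\<^sup>2"
    and prod: "K\<^sup>2 * ((e\<^sub>0 + e\<^sub>1) * (e\<^sub>1 + e\<^sub>2)) = 4 * \<kappa>\<^sup>2 * (1 + (K * e\<^sub>1)\<^sup>2)"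
  shows "angle_at (Z + (k\<^sup>2 / e\<^sub>0) *\<^sub>R v\<^sub>0) (Z + (k\<^sup>2 / e\<^sub>1) *\<^sub>R v\<^sub>1) (Z + (k\<^sup>2 / e\<^sub>2) *\<^sub>R v\<^sub>2)
    = arccos (sgn (e\<^sub>0 * e\<^sub>2) * ((1 - (K * e\<^sub>1)\<^sup>2) / (1 + (K * e\<^sub>1)\<^sup>2)))"
proof -
  have polar: "x \<bullet> y = ((norm x)\<^sup>2 + (norm y)\<^sup>2 - (dist x y)\<^sup>2) / 2" for x y :: complex
    by (simp add: dist_norm power2_norm_eq_inner inner_diff inner_commute)
  have i01: "v\<^sub>0 \<bullet> v\<^sub>1 = (e\<^sub>0 + e\<^sub>1) / 2 - r\<^sup>2"
    and i12: "v\<^sub>1 \<bullet> v\<^sub>2 = (e\<^sub>1 + e\<^sub>2) / 2 - r\<^sup>2"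
    and i02: "v\<^sub>0 \<bullet> v\<^sub>2 = (e\<^sub>0 + e\<^sub>2) / 2 + r\<^sup>2 - 8 * r\<^sup>2 * \<kappa>\<^sup>2"
    unfolding polar v d by (simp_all add: field_simps)
  have side: "norm ((1 / a) *\<^sub>R x - (1 / b) *\<^sub>R y) = r * \<bar>1 / a + 1 / b\<bar>"
    if "a \<noteq> 0" "b \<noteq> 0" "(norm x)\<^sup>2 = a + r\<^sup>2" "(norm y)\<^sup>2 = b + r\<^sup>2" "x \<bullet> y = (a + b) / 2 - r\<^sup>2"
    for a b and x y :: complex
  proof -
    have "(norm ((1 / a) *\<^sub>R x - (1 / b) *\<^sub>R y))\<^sup>2
        = (norm x)\<^sup>2 / a\<^sup>2 - 2 * (x \<bullet> y) / (a * b) + (norm y)\<^sup>2 / b\<^sup>2"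
      unfolding norm_scaleR_diff_squared by (simp add: power_divide)
    also have "\<dots> = (r * \<bar>1 / a + 1 / b\<bar>)\<^sup>2"
      unfolding that(3,4,5) power_mult_distrib power2_abs using that(1,2)
      by (simp add: field_simps power2_eq_square)
    finally show ?thesis using \<open>r > 0\<close> by (subst (asm) power2_eq_iff_nonneg) auto
  qed
  define W where "W = (1 / e\<^sub>0 + 1 / e\<^sub>1) * (1 / e\<^sub>1 + 1 / e\<^sub>2)"
  define y where "y = K * e\<^sub>1"
  let ?a = "(1 / e\<^sub>0) *\<^sub>R v\<^sub>0 - (1 / e\<^sub>1) *\<^sub>R v\<^sub>1"
  let ?c = "(1 / e\<^sub>2) *\<^sub>R v\<^sub>2 - (1 / e\<^sub>1) *\<^sub>R v\<^sub>1"
  have na: "norm ?a = r * \<bar>1 / e\<^sub>0 + 1 / e\<^sub>1\<bar>"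
    using side[OF e(1,2) v(1,2) i01] .
  have nc: "norm ?c = r * \<bar>1 / e\<^sub>1 + 1 / e\<^sub>2\<bar>"
    using side[OF e(2,3) v(2,3) i12] by (simp add: norm_minus_commute)
  have norms: "norm ?a * norm ?c = r\<^sup>2 * \<bar>W\<bar>"
    unfolding na nc W_def by (simp add: abs_mult power2_eq_square)
  have "?a \<bullet> ?c = (v\<^sub>0 \<bullet> v\<^sub>2) / (e\<^sub>0 * e\<^sub>2) - (v\<^sub>0 \<bullet> v\<^sub>1) / (e\<^sub>0 * e\<^sub>1) - (v\<^sub>1 \<bullet> v\<^sub>2) / (e\<^sub>1 * e\<^sub>2) + (norm v\<^sub>1)\<^sup>2 / e\<^sub>1\<^sup>2"
    unfolding power2_norm_eq_inner
    by (simp add: inner_diff inner_commute power2_eq_square algebra_simps)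
  also have "\<dots> = r\<^sup>2 * (W - 8 * \<kappa>\<^sup>2 / (e\<^sub>0 * e\<^sub>2))"
    unfolding i01 i02 i12 v W_def using e by (simp add: field_simps power2_eq_square)
  finally have dot: "?a \<bullet> ?c = r\<^sup>2 * (W - 8 * \<kappa>\<^sup>2 / (e\<^sub>0 * e\<^sub>2))" .
  have y1: "1 + y\<^sup>2 > 0" by (simp add: add_pos_nonneg)
  define p where "p = (e\<^sub>0 + e\<^sub>1) * (e\<^sub>1 + e\<^sub>2)"
  have pK: "p * K\<^sup>2 = 4 * \<kappa>\<^sup>2 * (1 + y\<^sup>2)"
    using prod by (simp add: p_def y_def mult.commute)
  have p_pos: "p > 0"
  proof -
    have "p * K\<^sup>2 > 0" unfolding pK using y1 \<open>\<kappa> > 0\<close> by simp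
    then show ?thesis using \<open>K > 0\<close> by (simp add: zero_less_mult_iff)
  qed
  have W: "W = p / (e\<^sub>1\<^sup>2 * (e\<^sub>0 * e\<^sub>2))"
    using e by (simp add: W_def p_def field_simps power2_eq_square)
  have absW: "\<bar>W\<bar> = sgn (e\<^sub>0 * e\<^sub>2) * W"
    using p_pos e unfolding W by (auto simp: sgn_if abs_if zero_less_mult_iff divide_less_0_iff mult_less_0_iff)
  have W0: "W \<noteq> 0" using p_pos e by (simp add: W)
  have "8 * \<kappa>\<^sup>2 / (e\<^sub>0 * e\<^sub>2) / W = 2 * e\<^sub>1\<^sup>2 * (4 * \<kappa>\<^sup>2 / p)"
    unfolding W using e p_pos by (simp add: field_simps)
  also have "4 * \<kappa>\<^sup>2 / p = K\<^sup>2 / (1 + y\<^sup>2)"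
    using pK p_pos y1 by (simp add: field_simps)
  also have "2 * e\<^sub>1\<^sup>2 * (K\<^sup>2 / (1 + y\<^sup>2)) = 2 * y\<^sup>2 / (1 + y\<^sup>2)"
    by (simp add: y_def power_mult_distrib)
  finally have q: "8 * \<kappa>\<^sup>2 / (e\<^sub>0 * e\<^sub>2) / W = 2 * y\<^sup>2 / (1 + y\<^sup>2)" .
  have s: "sgn (e\<^sub>0 * e\<^sub>2) * sgn (e\<^sub>0 * e\<^sub>2) = 1" using e by (simp add: sgn_if)
  have "(?a \<bullet> ?c) / (norm ?a * norm ?c) = (W - 8 * \<kappa>\<^sup>2 / (e\<^sub>0 * e\<^sub>2)) / (sgn (e\<^sub>0 * e\<^sub>2) * W)"
    unfolding norms dot absW using \<open>r > 0\<close> by simp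
  also have "\<dots> = sgn (e\<^sub>0 * e\<^sub>2) * (1 - 8 * \<kappa>\<^sup>2 / (e\<^sub>0 * e\<^sub>2) / W)"
    using W0 e by (simp add: sgn_if field_simps)
  also have "1 - 8 * \<kappa>\<^sup>2 / (e\<^sub>0 * e\<^sub>2) / W = (1 - y\<^sup>2) / (1 + y\<^sup>2)"
    unfolding q using y1 by (simp add: field_simps)
  finally have cosine: "(?a \<bullet> ?c) / (norm ?a * norm ?c)
      = sgn (e\<^sub>0 * e\<^sub>2) * ((1 - y\<^sup>2) / (1 + y\<^sup>2))" .
  have sa: "Z + (k\<^sup>2 / e\<^sub>0) *\<^sub>R v\<^sub>0 - (Z + (k\<^sup>2 / e\<^sub>1) *\<^sub>R v\<^sub>1) = k\<^sup>2 *\<^sub>R ?a"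
    and sc: "Z + (k\<^sup>2 / e\<^sub>2) *\<^sub>R v\<^sub>2 - (Z + (k\<^sup>2 / e\<^sub>1) *\<^sub>R v\<^sub>1) = k\<^sup>2 *\<^sub>R ?c"
    by (simp_all add: scaleR_diff_right)
  show ?thesis
    unfolding angle_at_def sa sc cosine[unfolded y_def, symmetric] using \<open>k > 0\<close>
    by (simp add: power2_eq_square)
qed

lemma cos_half_angle_substitution: "(1 - y\<^sup>2) / (1 + y\<^sup>2) = cos (2 * arctan y)"
proof -
  have "1 + y\<^sup>2 > 0" by (simp add: add_pos_nonneg)
  then show ?thesis
    by (simp add: cos_double cos_arctan sin_arctan power_divide diff_divide_distrib)
qed

lemma tan_half_arccos: "tan (arccos ((1 - y\<^sup>2) / (1 + y\<^sup>2)) / 2) = \<bar>y\<bar>"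
proof -
  have "(1 - y\<^sup>2) / (1 + y\<^sup>2) = cos (2 * arctan \<bar>y\<bar>)"
    using cos_half_angle_substitution[of "\<bar>y\<bar>"] by simp
  moreover have "0 \<le> 2 * arctan \<bar>y\<bar>" "2 * arctan \<bar>y\<bar> \<le> pi"
    using arctan_ubound[of "\<bar>y\<bar>"] by auto
  ultimately show ?thesis by (simp add: arccos_cos tan_arctan)
qed

lemma tan_half_supplement_arccos: "tan ((pi - arccos (- ((1 - y\<^sup>2) / (1 + y\<^sup>2)))) / 2) = \<bar>y\<bar>"
proof -
  have "arccos (- ((1 - y\<^sup>2) / (1 + y\<^sup>2))) = pi - arccos ((1 - y\<^sup>2) / (1 + y\<^sup>2))"
    by (rule arccos_minus) (simp_all only: cos_half_angle_substitution cos_ge_minus_one cos_le_one)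
  then show ?thesis by (simp add: tan_half_arccos)
qed

section \<open>Quadratic forms and conics\<close>

definition quadratic_form ::
    "real \<Rightarrow> real \<Rightarrow> real \<Rightarrow> real \<Rightarrow> real \<Rightarrow> real \<Rightarrow> real \<Rightarrow> real \<Rightarrow> real \<Rightarrow> real" where
  "quadratic_form p q r u v w X Y T =
     p * X\<^sup>2 + q * X * Y + r * Y\<^sup>2 + u * X * T + v * Y * T + w * T\<^sup>2"

lemma quadratic_form_linear_substitution:
  "\<exists>p' q' r' u' v' w'. \<forall>X Y T.
     quadratic_form p q r u v w
       (a\<^sub>1 * X + a\<^sub>2 * Y + a\<^sub>3 * T) (b\<^sub>1 * X + b\<^sub>2 * Y + b\<^sub>3 * T) (c\<^sub>1 * X + c\<^sub>2 * Y + c\<^sub>3 * T)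
     = quadratic_form p' q' r' u' v' w' X Y T"
  unfolding quadratic_form_def
  apply (rule exI[of _ "p * a\<^sub>1\<^sup>2 + q * a\<^sub>1 * b\<^sub>1 + r * b\<^sub>1\<^sup>2 + u * a\<^sub>1 * c\<^sub>1 + v * b\<^sub>1 * c\<^sub>1 + w * c\<^sub>1\<^sup>2"])
  apply (rule exI[of _ "2 * p * a\<^sub>1 * a\<^sub>2 + q * (a\<^sub>1 * b\<^sub>2 + a\<^sub>2 * b\<^sub>1) + 2 * r * b\<^sub>1 * b\<^sub>2
    + u * (a\<^sub>1 * c\<^sub>2 + a\<^sub>2 * c\<^sub>1) + v * (b\<^sub>1 * c\<^sub>2 + b\<^sub>2 * c\<^sub>1) + 2 * w * c\<^sub>1 * c\<^sub>2"])
  apply (rule exI[of _ "p * a\<^sub>2\<^sup>2 + q * a\<^sub>2 * b\<^sub>2 + r * b\<^sub>2\<^sup>2 + u * a\<^sub>2 * c\<^sub>2 + v * b\<^sub>2 * c\<^sub>2 + w * c\<^sub>2\<^sup>2"])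
  apply (rule exI[of _ "2 * p * a\<^sub>1 * a\<^sub>3 + q * (a\<^sub>1 * b\<^sub>3 + a\<^sub>3 * b\<^sub>1) + 2 * r * b\<^sub>1 * b\<^sub>3
    + u * (a\<^sub>1 * c\<^sub>3 + a\<^sub>3 * c\<^sub>1) + v * (b\<^sub>1 * c\<^sub>3 + b\<^sub>3 * c\<^sub>1) + 2 * w * c\<^sub>1 * c\<^sub>3"])
  apply (rule exI[of _ "2 * p * a\<^sub>2 * a\<^sub>3 + q * (a\<^sub>2 * b\<^sub>3 + a\<^sub>3 * b\<^sub>2) + 2 * r * b\<^sub>2 * b\<^sub>3
    + u * (a\<^sub>2 * c\<^sub>3 + a\<^sub>3 * c\<^sub>2) + v * (b\<^sub>2 * c\<^sub>3 + b\<^sub>3 * c\<^sub>2) + 2 * w * c\<^sub>2 * c\<^sub>3"])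
  apply (rule exI[of _ "p * a\<^sub>3\<^sup>2 + q * a\<^sub>3 * b\<^sub>3 + r * b\<^sub>3\<^sup>2 + u * a\<^sub>3 * c\<^sub>3 + v * b\<^sub>3 * c\<^sub>3 + w * c\<^sub>3\<^sup>2"])
  by (intro allI) algebra

text \<open>Five points of the circle suffice: the multiples of \<open>\<pi>/2\<close> leave only the mixed term, and \<open>\<pi>/4\<close>
  removes it.\<close>

lemma quadratic_form_vanishing_on_circle:
  assumes "\<And>s. quadratic_form p q r u v w (cos s) (sin s) 1 = 0"
  shows "quadratic_form p q r u v w X Y T = p * (X\<^sup>2 + Y\<^sup>2 - T\<^sup>2)"
proof -
  note F = assms[unfolded quadratic_form_def]
  have "p + u + w = 0" using F[of 0] by simp
  moreover have "p - u + w = 0" using F[of pi] by simp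
  moreover have "r + v + w = 0" using F[of "pi / 2"] by simp
  moreover have "r - v + w = 0" using F[of "- (pi / 2)"] by simp
  ultimately have "u = 0" "v = 0" "w = - p" "r = p" by linarith+
  moreover from this have "q = 0"
    using F[of "pi / 4"] by (simp add: cos_45 sin_45 power2_eq_square)
  ultimately show ?thesis by (simp add: quadratic_form_def algebra_simps)
qed

text \<open>The polynomial in \<open>y\<close> vanishes identically, so its three coefficients do. They say that the
  symmetric bilinear form has a totally isotropic plane, which no nonsingular form in three variables
  has.\<close>

lemma quadratic_form_vanishing_on_line_degenerate:
  fixes p q r u v w :: real
  assumes "\<And>y. quadratic_form p q r u v w (x\<^sub>0 + y * \<alpha>) (y\<^sub>0 + y * \<beta>) 1 = 0"
    and "\<alpha> \<noteq> 0 \<or> \<beta> \<noteq> 0"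
  shows "4 * p * r * w + q * u * v - p * v\<^sup>2 - r * u\<^sup>2 - w * q\<^sup>2 = 0"
proof -
  note F = assms(1)[unfolded quadratic_form_def]
  have 0: "p * x\<^sub>0\<^sup>2 + q * x\<^sub>0 * y\<^sub>0 + r * y\<^sub>0\<^sup>2 + u * x\<^sub>0 + v * y\<^sub>0 + w = 0"
    using F[of 0] by simp
  have 1: "2 * p * x\<^sub>0 * \<alpha> + q * (x\<^sub>0 * \<beta> + y\<^sub>0 * \<alpha>) + 2 * r * y\<^sub>0 * \<beta> + u * \<alpha> + v * \<beta> = 0"
    using F[of 1] F[of "-1"] by (simp add: power2_eq_square algebra_simps)
  have 2: "p * \<alpha>\<^sup>2 + q * \<alpha> * \<beta> + r * \<beta>\<^sup>2 = 0"
    using F[of 1] F[of "-1"] 0 by (simp add: power2_eq_square algebra_simps)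
  let ?D = "4 * p * r * w + q * u * v - p * v\<^sup>2 - r * u\<^sup>2 - w * q\<^sup>2"
  have "?D * \<alpha>\<^sup>2 = 0" using 0 1 2 by algebra
  moreover have "?D * \<beta>\<^sup>2 = 0" using 0 1 2 by algebra
  ultimately show ?thesis using assms(2) by auto
qed

section \<open>Trigonometric sums\<close>

lemma countable_zeros_cos_sin:
  fixes \<alpha> \<beta> \<gamma> :: real
  assumes "\<gamma> \<noteq> 0"
  shows "countable {s. \<gamma> + (\<alpha> * cos s + \<beta> * sin s) = 0}"
proof -
  define z where "z = Complex \<alpha> \<beta>"
  have pol: "\<alpha> * cos s + \<beta> * sin s = norm z * cos (s - Arg z)" for s
  proof -
    have "\<alpha> = norm z * cos (Arg z)" "\<beta> = norm z * sin (Arg z)"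
      using rcis_cmod_Arg[of z] by (auto simp: z_def rcis_def complex_eq_iff)
    then show ?thesis by (simp add: cos_diff algebra_simps)
  qed
  define y where "y = arccos (- \<gamma> / norm z)"
  have "{s. \<gamma> + (\<alpha> * cos s + \<beta> * sin s) = 0}
      \<subseteq> (\<lambda>n::int. Arg z + y + 2 * of_int n * pi) ` UNIV \<union> (\<lambda>n::int. Arg z - y + 2 * of_int n * pi) ` UNIV"
  proof
    fix s assume "s \<in> {s. \<gamma> + (\<alpha> * cos s + \<beta> * sin s) = 0}"
    then have *: "\<gamma> + norm z * cos (s - Arg z) = 0" by (simp add: pol)
    then have "z \<noteq> 0" using assms by auto
    then have "cos (s - Arg z) = - \<gamma> / norm z" using * by (simp add: field_simps)
    moreover from this have "cos y = - \<gamma> / norm z"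
      unfolding y_def by (metis cos_arccos cos_ge_minus_one cos_le_one)
    ultimately have "cos (s - Arg z) = cos y" by simp
    then obtain n where "n \<in> \<int>" and n: "s - Arg z = y + 2 * n * pi \<or> s - Arg z = - y + 2 * n * pi"
      by (auto simp: cos_eq)
    then obtain m where "n = of_int m" by (auto elim: Ints_cases)
    with n show "s \<in> (\<lambda>n::int. Arg z + y + 2 * of_int n * pi) ` UNIV \<union> (\<lambda>n::int. Arg z - y + 2 * of_int n * pi) ` UNIV"
      by (auto simp: image_iff algebra_simps)
  qed
  then show ?thesis by (rule countable_subset) simp
qed

lemma sum_rotated_roots_of_unity:
  assumes "N > 1"
  shows "(\<Sum>i = 1..N. cis (t + 2 * pi * real i / real N)) = 0"
proof -
  define \<omega> where "\<omega> = cis (2 * pi / real N)"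
  have "real N * (2 * pi / real N) = 2 * pi" using assms by simp
  then have "\<omega> ^ N = 1" by (simp only: \<omega>_def Complex.DeMoivre cis_2pi)
  moreover have "\<omega> \<noteq> 1"
  proof
    assume "\<omega> = 1"
    with assms obtain k :: int where "2 * pi / real N = 2 * pi * of_int k"
      by (auto simp: \<omega>_def complex_eq_iff cos_one_2pi_int)
    with assms have "real N * of_int k = 1" by (simp add: field_simps)
    also have "real N * of_int k = of_int (int N * k)" by simp
    finally have "int N * k = 1" by linarith
    then show False using assms by (auto simp: zmult_eq_1_iff)
  qed
  ultimately have "(\<Sum>i<N. \<omega> ^ i) = 0" by (simp add: geometric_sum)
  moreover have "cis (t + 2 * pi * real (Suc i) / real N) = cis t * \<omega> * \<omega> ^ i" for i
    by (simp add: \<omega>_def Complex.DeMoivre cis_mult add_divide_distrib algebra_simps)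
  then have "(\<Sum>i = 1..N. cis (t + 2 * pi * real i / real N)) = cis t * \<omega> * (\<Sum>i<N. \<omega> ^ i)"
    unfolding sum.shift_bounds_Suc_ivl sum_distrib_left
    by (simp only: sum_bounds_lt_plus1[symmetric] cong: sum.cong)
  ultimately show ?thesis by simp
qed

section \<open>The powers of the center of inversion\<close>

text \<open>A circle of the chain is given by the angle \<open>s\<close> at which its center is seen from \<open>c\<close>. All
  \<open>position\<close>s are relative to \<open>Z\<close>; \<open>b\<close> is the one of \<open>c\<close>, \<open>r\<close> is the radius of the chain circles and
  \<open>h\<close> the radius of the circle through their points of contact, which is orthogonal to all of them.\<close>

locale steiner_porism =
  fixes N :: nat and c Z :: complex and R k :: real
  assumes N: "N \<ge> 3" and R: "R > 0" and k: "k > 0"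
begin

definition b where "b = c - Z"
definition r where "r = R * sin (pi / real N)"
definition h where "h = R * cos (pi / real N)"
definition position :: "real \<Rightarrow> complex" where "position s = b + of_real R * cis s"
definition circle_power :: "real \<Rightarrow> real" where "circle_power s = (norm (position s))\<^sup>2 - r\<^sup>2"
definition image_center :: "real \<Rightarrow> complex" where
  "image_center s = Z + (k\<^sup>2 / circle_power s) *\<^sub>R position s"
definition mean_power where "mean_power = (norm b)\<^sup>2 + h\<^sup>2"

lemma angle_bounds: "0 < pi / real N" "pi / real N \<le> pi / 3"
proof -
  show "0 < pi / real N" using N by simp
  have "3 \<le> real N" using N by simp
  then show "pi / real N \<le> pi / 3" by (intro divide_left_mono) auto
qed

lemma r_pos: "r > 0"
proof -
  have lt: "pi / real N < pi" by (rule le_less_trans[OF angle_bounds(2)]) simp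
  then show ?thesis
    unfolding r_def by (intro mult_pos_pos sin_gt_zero R angle_bounds lt)
qed

lemma cos_step_ge_half: "cos (pi / real N) \<ge> 1 / 2"
  using cos_monotone_0_pi_le[of "pi / real N" "pi / 3"] angle_bounds by (simp add: cos_60)

lemma h_pos: "h > 0"
  unfolding h_def using R cos_step_ge_half by (intro mult_pos_pos) auto

lemma h_r: "h\<^sup>2 + r\<^sup>2 = R\<^sup>2"
  unfolding h_def r_def power_mult_distrib distrib_left[symmetric] by simp

lemma mean_power_pos: "mean_power > 0"
  unfolding mean_power_def using h_pos by (intro add_nonneg_pos) auto

lemma circle_power_eq: "circle_power s = mean_power + 2 * R * (b \<bullet> cis s)"
proof -
  have "(norm (position s))\<^sup>2 = (norm b)\<^sup>2 + R\<^sup>2 + 2 * R * (b \<bullet> cis s)"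
    unfolding position_def power2_norm_eq_inner
    by (simp add: inner_add inner_commute inner_complex_def[of "cis s"] inner_complex_def[of "_ * _"]
        power2_eq_square algebra_simps)
      (simp add: inner_complex_def algebra_simps sin_squared_eq flip: power2_eq_square)
  then show ?thesis unfolding circle_power_def mean_power_def using h_r by simp
qed

lemma family_iff:
  "P \<in> steiner_soddy_family N c R Z k \<longleftrightarrow>
   (\<exists>t. \<forall>i. circle_power (t + 2 * pi * real i / real N) \<noteq> 0 \<and>
            P i = image_center (t + 2 * pi * real i / real N))"
proof -
  have circle: "chain_circle N c R t i = sphere (Z + position (t + 2 * pi * real i / real N)) r" for t i
    by (simp add: chain_circle_def ngon_vertex_def position_def b_def r_def add.assoc)
  have "(\<exists>\<rho>>0. inversion Z k ` sphere (Z + position s) r = sphere p \<rho>) \<longleftrightarrow>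
      circle_power s \<noteq> 0 \<and> p = image_center s" for s p
  proof (cases "circle_power s = 0")
    case True
    then show ?thesis
      using inversion_image_sphere_through_center[OF k _ r_pos] by (auto simp: circle_power_def)
  next
    case False
    then have img: "inversion Z k ` sphere (Z + position s) r
        = sphere (image_center s) (k\<^sup>2 * r / \<bar>circle_power s\<bar>)"
      using inversion_image_sphere[OF k r_pos] by (simp add: circle_power_def image_center_def)
    have pos: "k\<^sup>2 * r / \<bar>circle_power s\<bar> > 0"
      using k r_pos False by simp
    show ?thesis unfolding img
      using sphere_center_unique[OF _ pos] pos False by metis
  qed
  then show ?thesis by (simp add: steiner_soddy_family_def circle)
qed

lemma dist_position: "(dist (position s) (position (s + 2 * \<delta>)))\<^sup>2 = (2 * R * sin \<delta>)\<^sup>2"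
proof -
  have "position s - position (s + 2 * \<delta>) = of_real R * (cis s - cis (s + 2 * \<delta>))"
    by (simp add: position_def algebra_simps)
  moreover have "(norm (cis s - cis (s + 2 * \<delta>)))\<^sup>2 = 2 - 2 * cos (2 * \<delta>)"
  proof -
    have "(norm (cis s - cis (s + 2 * \<delta>)))\<^sup>2
        = ((cos s)\<^sup>2 + (sin s)\<^sup>2) + ((cos (s + 2 * \<delta>))\<^sup>2 + (sin (s + 2 * \<delta>))\<^sup>2)
          - 2 * (cos (s + 2 * \<delta>) * cos s + sin (s + 2 * \<delta>) * sin s)"
      unfolding cmod_power2 by (simp add: power2_eq_square algebra_simps)
    also have "\<dots> = 2 - 2 * cos ((s + 2 * \<delta>) - s)"
      unfolding cos_diff by simp
    finally show ?thesis by simp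
  qed
  ultimately show ?thesis
    by (simp add: dist_norm norm_mult power_mult_distrib cos_double_sin)
qed

lemma dist_consecutive: "(dist (position s) (position (s + 2 * (pi / real N))))\<^sup>2 = 4 * r\<^sup>2"
  unfolding dist_position by (simp add: r_def power_mult_distrib)

lemma dist_second:
  "(dist (position (s - 2 * (pi / real N))) (position (s + 2 * (pi / real N))))\<^sup>2
     = 16 * r\<^sup>2 * (cos (pi / real N))\<^sup>2"
proof -
  have "s - 2 * (pi / real N) + 2 * (2 * (pi / real N)) = s + 2 * (pi / real N)" by simp
  then show ?thesis
    using dist_position[of "s - 2 * (pi / real N)" "2 * (pi / real N)"]
    by (simp only: sin_double r_def power_mult_distrib) (simp add: power_mult_distrib)
qed

text \<open>Two circles that both have \<open>Z\<close> in their interior overlap, so their centers are closer than two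
  radii. Tangent circles and circles two steps apart do not overlap; for \<open>N = 3\<close> the latter are tangent.\<close>

lemma dist_position_less:
  assumes "circle_power s < 0" "circle_power t < 0"
  shows "(dist (position s) (position t))\<^sup>2 < 4 * r\<^sup>2"
proof -
  have "(norm (position s))\<^sup>2 < r\<^sup>2" "(norm (position t))\<^sup>2 < r\<^sup>2"
    using assms by (auto simp: circle_power_def)
  then have "norm (position s) < r" "norm (position t) < r"
    using r_pos by (auto intro: power2_less_imp_less)
  then have "dist (position s) (position t) < 2 * r"
    by (smt (verit) dist_norm norm_triangle_ineq4)
  then have "(dist (position s) (position t))\<^sup>2 < (2 * r)\<^sup>2" by (intro power_strict_mono) auto
  then show ?thesis by (simp add: power_mult_distrib)
qed

lemma consecutive_not_both_negative:
  "circle_power s \<ge> 0 \<or> circle_power (s + 2 * (pi / real N)) \<ge> 0"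
  using dist_position_less[of s "s + 2 * (pi / real N)"] dist_consecutive[of s] by fastforce

lemma second_neighbours_not_both_negative:
  "circle_power (s - 2 * (pi / real N)) \<ge> 0 \<or> circle_power (s + 2 * (pi / real N)) \<ge> 0"
proof -
  have "(1 / 2)\<^sup>2 \<le> (cos (pi / real N))\<^sup>2"
    using cos_step_ge_half by (intro power_mono) auto
  then have "16 * r\<^sup>2 * (1 / 4) \<le> 16 * r\<^sup>2 * (cos (pi / real N))\<^sup>2"
    by (intro mult_left_mono) (auto simp: power2_eq_square)
  then show ?thesis
    using dist_position_less[of "s - 2 * (pi / real N)" "s + 2 * (pi / real N)"]
    unfolding dist_second by fastforce
qed

text \<open>The radius \<open>k\<^sup>2 h / |h\<^sup>2 - |b|\<^sup>2|\<close> of the circle touching the lines of all sides, divided by \<open>k\<^sup>2 r\<close>.\<close>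

definition tan_factor where "tan_factor = h / (r * \<bar>h\<^sup>2 - (norm b)\<^sup>2\<bar>)"

text \<open>The relation behind the existence of a circle touching all sides. With \<open>x = b \<bullet> cis s\<close>, the neighboring powers
  come from rotating by \<open>\<plusminus> 2\<pi>/N\<close>, and the component \<open>y\<close> of \<open>b\<close> in the orthogonal direction drops out through
  \<open>x\<^sup>2 + y\<^sup>2 = |b|\<^sup>2\<close>.\<close>

lemma circle_power_product:
  "(circle_power (s - 2 * (pi / real N)) + circle_power s) *
     (circle_power s + circle_power (s + 2 * (pi / real N)))
   = 4 * (cos (pi / real N))\<^sup>2 * (circle_power s)\<^sup>2
     + 4 * (sin (pi / real N))\<^sup>2 * (h\<^sup>2 - (norm b)\<^sup>2)\<^sup>2"
proof -
  define \<kappa> \<sigma> where "\<kappa> = cos (pi / real N)" and "\<sigma> = sin (pi / real N)"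
  define x y where "x = b \<bullet> cis s" and "y = b \<bullet> (\<i> * cis s)"
  have c2: "cos (2 * (pi / real N)) = 2 * \<kappa>\<^sup>2 - 1" "sin (2 * (pi / real N)) = 2 * \<sigma> * \<kappa>"
    by (simp_all only: \<kappa>_def \<sigma>_def cos_double_cos sin_double)
  have xp: "b \<bullet> cis (s + 2 * (pi / real N)) = (2 * \<kappa>\<^sup>2 - 1) * x + 2 * \<sigma> * \<kappa> * y"
    unfolding c2[symmetric] by (simp add: x_def y_def inner_complex_def cos_add sin_add algebra_simps)
  have xm: "b \<bullet> cis (s - 2 * (pi / real N)) = (2 * \<kappa>\<^sup>2 - 1) * x - 2 * \<sigma> * \<kappa> * y"
    unfolding c2[symmetric] by (simp add: x_def y_def inner_complex_def cos_diff sin_diff algebra_simps)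
  have sq: "\<sigma>\<^sup>2 + \<kappa>\<^sup>2 = 1" by (simp add: \<kappa>_def \<sigma>_def)
  have h: "h = R * \<kappa>" by (simp add: h_def \<kappa>_def)
  have "x\<^sup>2 + y\<^sup>2 = ((Re b)\<^sup>2 + (Im b)\<^sup>2) * ((sin s)\<^sup>2 + (cos s)\<^sup>2)"
    unfolding x_def y_def inner_complex_def by (simp del: sin_cos_squared_add) algebra
  then have xy: "x\<^sup>2 + y\<^sup>2 = (norm b)\<^sup>2" by (simp add: cmod_power2)
  show ?thesis
    unfolding circle_power_eq xp xm x_def[symmetric] mean_power_def \<kappa>_def[symmetric] \<sigma>_def[symmetric]
    using sq h xy by algebra
qed

lemma sum_circle_power: "(\<Sum>i = 1..N. circle_power (t + 2 * pi * real i / real N)) = real N * mean_power"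
proof -
  have "(\<Sum>i = 1..N. circle_power (t + 2 * pi * real i / real N))
      = real N * mean_power + 2 * R * (b \<bullet> (\<Sum>i = 1..N. cis (t + 2 * pi * real i / real N)))"
    by (simp add: circle_power_eq sum.distrib inner_sum_right sum_distrib_left)
  then show ?thesis using sum_rotated_roots_of_unity[of N t] N by simp
qed

end

section \<open>The conic through the centers\<close>

locale inscribed_steiner_porism = steiner_porism +
  fixes E :: "complex set"
  assumes conic: "nondegenerate_conic E"
    and inscribed: "\<And>P i. P \<in> steiner_soddy_family N c R Z k \<Longrightarrow> P i \<in> E"
begin

lemma image_center_in_E_generic:
  assumes "\<And>i::nat. circle_power (s + 2 * pi * real i / real N) \<noteq> 0"
  shows "image_center s \<in> E"
proof -
  have "(\<lambda>i. image_center (s + 2 * pi * real i / real N)) \<in> steiner_soddy_family N c R Z k"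
    unfolding family_iff using assms by blast
  from inscribed[OF this, of 0] show ?thesis by simp
qed

text \<open>Rotations for which a circle of the chain passes through \<open>Z\<close> give no polygon. They are too few to
  matter: whatever depends continuously on \<open>s\<close> and vanishes at all others vanishes everywhere.\<close>

lemma countable_special_rotations:
  "countable {s. \<exists>i::nat. circle_power (s + 2 * pi * real i / real N) = 0}"
proof -
  \<comment> \<open>The constant \<open>mean_power\<close> is positive, so the power does not vanish identically even for \<open>b = 0\<close>.\<close>
  have zeros: "countable {s. circle_power s = 0}"
    using countable_zeros_cos_sin[of mean_power "2 * R * Re b" "2 * R * Im b"] mean_power_pos
    by (simp add: circle_power_eq inner_complex_def algebra_simps)
  have "{s. \<exists>i::nat. circle_power (s + 2 * pi * real i / real N) = 0}
      = (\<Union>i::nat. (\<lambda>s. s - 2 * pi * real i / real N) ` {s. circle_power s = 0})"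
  proof (intro subset_antisym subsetI)
    fix s assume "s \<in> {s. \<exists>i::nat. circle_power (s + 2 * pi * real i / real N) = 0}"
    then obtain i :: nat where "circle_power (s + 2 * pi * real i / real N) = 0" by auto
    then show "s \<in> (\<Union>i::nat. (\<lambda>s. s - 2 * pi * real i / real N) ` {s. circle_power s = 0})"
      by (intro UN_I[of i] image_eqI[of _ _ "s + 2 * pi * real i / real N"]) auto
  next
    fix s assume "s \<in> (\<Union>i::nat. (\<lambda>s. s - 2 * pi * real i / real N) ` {s. circle_power s = 0})"
    then obtain i :: nat and x where "s = x - 2 * pi * real i / real N" "circle_power x = 0" by auto
    then have "circle_power (s + 2 * pi * real i / real N) = 0" by simp
    then show "s \<in> {s. \<exists>i::nat. circle_power (s + 2 * pi * real i / real N) = 0}" by blast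
  qed
  then show ?thesis using zeros by simp
qed

text \<open>For \<open>|b| \<noteq> h\<close> this is the affine function with the value \<open>1 / circle_power s\<close> at \<open>image_center s\<close>. It
  vanishes on the image of the line at infinity under the projective map from the circle to the
  centers.\<close>

definition reciprocal_power :: "complex \<Rightarrow> real" where
  "reciprocal_power z = (1 - (2 / k\<^sup>2) * (b \<bullet> (z - Z))) / (h\<^sup>2 - (norm b)\<^sup>2)"

lemma reciprocal_power_image_center:
  assumes "norm b \<noteq> h" "circle_power s \<noteq> 0"
  shows "reciprocal_power (image_center s) = 1 / circle_power s"
proof -
  have "h\<^sup>2 - (norm b)\<^sup>2 \<noteq> 0" using assms(1) h_pos by (simp add: power2_eq_iff_nonneg)
  moreover have "2 * (b \<bullet> position s) = circle_power s - (h\<^sup>2 - (norm b)\<^sup>2)"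
    unfolding circle_power_eq mean_power_def position_def
    by (simp add: inner_add_right power2_norm_eq_inner)
      (simp add: inner_complex_def algebra_simps)
  moreover have "reciprocal_power (image_center s)
      = (1 - 2 * (b \<bullet> position s) / circle_power s) / (h\<^sup>2 - (norm b)\<^sup>2)"
    using k by (simp add: reciprocal_power_def image_center_def)
  moreover from calculation(2)
  have "1 - 2 * (b \<bullet> position s) / circle_power s = (h\<^sup>2 - (norm b)\<^sup>2) / circle_power s"
    using assms(2) by (simp only: diff_divide_distrib) simp
  ultimately show ?thesis by simp
qed

text \<open>The case \<open>|b| = h\<close> is that of \<open>Z\<close> on the circle through the points of contact, where all centers are
  on one line. Both the first and the third claim hold because otherwise the pulled back quadratic
  form, which is \<open>A (X\<^sup>2 + Y\<^sup>2 - T\<^sup>2)\<close>, has a zero off the cone \<open>X\<^sup>2 + Y\<^sup>2 = T\<^sup>2\<close>, hence \<open>A = 0\<close>. Then the form of \<open>E\<close>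
  vanishes on the image of the projective map, which is that line for \<open>|b| = h\<close> and everything otherwise.\<close>

lemma conic_is_image_of_circle:
  shows "norm b \<noteq> h"
    and "\<And>s. circle_power s \<noteq> 0 \<Longrightarrow> image_center s \<in> E"
    and "\<And>z. z \<in> E \<Longrightarrow> reciprocal_power z \<noteq> 0"
proof -
  from conic obtain p q r' u v w where
    E': "E = {z. p * (Re z)\<^sup>2 + q * Re z * Im z + r' * (Im z)\<^sup>2 + u * Re z + v * Im z + w = 0}" and
    det: "4 * p * r' * w + q * u * v - p * v\<^sup>2 - r' * u\<^sup>2 - w * q\<^sup>2 \<noteq> 0"
    unfolding nondegenerate_conic_def by blast
  have E: "E = {z. quadratic_form p q r' u v w (Re z) (Im z) 1 = 0}"
    unfolding quadratic_form_def E' by simp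
  let ?Q = "quadratic_form p q r' u v w"
  \<comment> \<open>In homogeneous coordinates \<open>(X, Y, T)\<close>, with \<open>X = cos s\<close>, \<open>Y = sin s\<close>, \<open>T = 1\<close> on the circle, the
    map \<open>s \<mapsto> image_center s\<close> becomes linear; the third component is the power.\<close>
  define \<tau> where "\<tau> X Y T = 2 * R * Re b * X + 2 * R * Im b * Y + mean_power * T" for X Y T
  define \<xi> where "\<xi> X Y T = Re Z * \<tau> X Y T + k\<^sup>2 * (Re b * T + R * X)" for X Y T
  define \<eta> where "\<eta> X Y T = Im Z * \<tau> X Y T + k\<^sup>2 * (Im b * T + R * Y)" for X Y T
  obtain A q' r'' u' v' w' where
    G: "\<And>X Y T. ?Q (\<xi> X Y T) (\<eta> X Y T) (\<tau> X Y T) = quadratic_form A q' r'' u' v' w' X Y T"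
  proof -
    have lin: "\<xi> X Y T = (Re Z * (2 * R * Re b) + k\<^sup>2 * R) * X + (Re Z * (2 * R * Im b)) * Y + (Re Z * mean_power + k\<^sup>2 * Re b) * T"
      "\<eta> X Y T = (Im Z * (2 * R * Re b)) * X + (Im Z * (2 * R * Im b) + k\<^sup>2 * R) * Y + (Im Z * mean_power + k\<^sup>2 * Im b) * T" for X Y T
      by (simp_all add: \<xi>_def \<eta>_def \<tau>_def algebra_simps)
    show thesis
      using that quadratic_form_linear_substitution[of p q r' u v w "Re Z * (2 * R * Re b) + k\<^sup>2 * R"
          "Re Z * (2 * R * Im b)" "Re Z * mean_power + k\<^sup>2 * Re b" "Im Z * (2 * R * Re b)"
          "Im Z * (2 * R * Im b) + k\<^sup>2 * R" "Im Z * mean_power + k\<^sup>2 * Im b" "2 * R * Re b" "2 * R * Im b" mean_power]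
      unfolding lin[symmetric] \<tau>_def[symmetric] by blast
  qed
  let ?G = "quadratic_form A q' r'' u' v' w'"
  have \<tau>_power: "\<tau> (cos s) (sin s) 1 = circle_power s" for s
    by (simp add: \<tau>_def circle_power_eq inner_complex_def algebra_simps)
  have G_power: "?G (cos s) (sin s) 1
      = (circle_power s)\<^sup>2 * ?Q (Re (image_center s)) (Im (image_center s)) 1"
    if "circle_power s \<noteq> 0" for s
  proof -
    have "\<xi> (cos s) (sin s) 1 = circle_power s * Re (image_center s)"
      "\<eta> (cos s) (sin s) 1 = circle_power s * Im (image_center s)"
      using that by (simp_all add: \<xi>_def \<eta>_def \<tau>_power image_center_def position_def field_simps)
    then show ?thesis unfolding G[symmetric] \<tau>_power
      by (simp add: quadratic_form_def power2_eq_square algebra_simps)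
  qed
  have G_circle: "?G (cos s) (sin s) 1 = 0" for s
  proof (rule ccontr)
    assume "?G (cos s) (sin s) 1 \<noteq> 0"
    moreover have "open {s. ?G (cos s) (sin s) 1 \<noteq> 0}"
      unfolding quadratic_form_def by (intro open_Collect_neq continuous_intros)
    ultimately obtain s' where "?G (cos s') (sin s') 1 \<noteq> 0"
      and s': "\<And>i::nat. circle_power (s' + 2 * pi * real i / real N) \<noteq> 0"
      using open_minus_countable[OF countable_special_rotations, of "{s. ?G (cos s) (sin s) 1 \<noteq> 0}"]
      by blast
    moreover have "circle_power s' \<noteq> 0" using s'[of 0] by simp
    ultimately show False
      using image_center_in_E_generic[OF s'] G_power[of s'] by (simp add: E)
  qed
  have G_eq: "?G X Y T = A * (X\<^sup>2 + Y\<^sup>2 - T\<^sup>2)" for X Y T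
    by (rule quadratic_form_vanishing_on_circle) (rule G_circle)
  show on_E: "image_center s \<in> E" if "circle_power s \<noteq> 0" for s
    using G_power[OF that] G_circle[of s] that by (simp add: E)
  \<comment> \<open>These \<open>z\<close> are the images of the points at infinity, those with \<open>T = 0\<close>.\<close>
  have infinity: "?Q (Re z) (Im z) 1 = A * (norm (z - Z) / (k\<^sup>2 * R))\<^sup>2"
    if "2 * (b \<bullet> (z - Z)) = k\<^sup>2" for z
  proof -
    define X Y where "X = Re (z - Z) / (k\<^sup>2 * R)" and "Y = Im (z - Z) / (k\<^sup>2 * R)"
    have "\<tau> X Y 0 = 2 * (b \<bullet> (z - Z)) / k\<^sup>2"
      using R k by (simp add: \<tau>_def X_def Y_def inner_complex_def field_simps)
    then have \<tau>1: "\<tau> X Y 0 = 1" using that k by simp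
    have "\<xi> X Y 0 = Re z" "\<eta> X Y 0 = Im z"
      unfolding \<xi>_def \<eta>_def \<tau>1 using R k by (simp_all add: X_def Y_def)
    then have "?Q (Re z) (Im z) 1 = A * (X\<^sup>2 + Y\<^sup>2)"
      using G[of X Y 0] G_eq[of X Y 0] \<tau>1 by simp
    also have "X\<^sup>2 + Y\<^sup>2 = (norm (z - Z) / (k\<^sup>2 * R))\<^sup>2"
      unfolding X_def Y_def power_divide cmod_power2 by (simp add: add_divide_distrib)
    finally show ?thesis .
  qed
  show bh: "norm b \<noteq> h"
  proof
    assume bh: "norm b = h"
    have b0: "norm b \<noteq> 0" using bh h_pos by simp
    have b2: "(Re b)\<^sup>2 + (Im b)\<^sup>2 = h\<^sup>2" using bh cmod_power2[of b] by simp
    \<comment> \<open>For \<open>|b| = h\<close> the linear map is singular, and this vector spans its kernel.\<close>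
    have "\<tau> (- Re b) (- Im b) R = R * (mean_power - 2 * ((Re b)\<^sup>2 + (Im b)\<^sup>2))"
      by (simp add: \<tau>_def power2_eq_square algebra_simps)
    also have "\<dots> = 0" unfolding b2 mean_power_def bh by simp
    finally have "?G (- Re b) (- Im b) R = 0"
      unfolding G[symmetric] by (simp add: \<xi>_def \<eta>_def quadratic_form_def)
    then have "A * (h\<^sup>2 - R\<^sup>2) = 0" unfolding G_eq using b2 by simp
    then have "A = 0" using h_r r_pos by auto
    then have "?Q (Re z) (Im z) 1 = 0" if "2 * (b \<bullet> (z - Z)) = k\<^sup>2" for z
      using infinity[OF that] by simp
    note on_line = this
    define m where "m = Z + (k\<^sup>2 / (2 * (norm b)\<^sup>2)) *\<^sub>R b"
    have "2 * (b \<bullet> (m + y *\<^sub>R (\<i> * b) - Z)) = k\<^sup>2" for y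
    proof -
      have "b \<bullet> (\<i> * b) = 0" by (simp add: inner_complex_def)
      then show ?thesis
        using b0 by (simp add: m_def inner_add_right inner_diff_right power2_norm_eq_inner)
    qed
    from on_line[OF this] have "?Q (Re m + y * - Im b) (Im m + y * Re b) 1 = 0" for y
      by simp
    moreover have "- Im b \<noteq> 0 \<or> Re b \<noteq> 0" using b0 by (auto simp: complex_eq_iff)
    ultimately show False
      using quadratic_form_vanishing_on_line_degenerate det by blast
  qed
  show "reciprocal_power z \<noteq> 0" if z: "z \<in> E" for z
  proof
    assume "reciprocal_power z = 0"
    have hb: "h\<^sup>2 - (norm b)\<^sup>2 \<noteq> 0" using bh h_pos by (simp add: power2_eq_iff_nonneg)
    then have line: "2 * (b \<bullet> (z - Z)) = k\<^sup>2"
      using \<open>reciprocal_power z = 0\<close> k by (simp add: reciprocal_power_def field_simps)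
    have "A * (norm (z - Z) / (k\<^sup>2 * R))\<^sup>2 = 0"
      using infinity[OF line] z by (simp add: E)
    moreover have "z \<noteq> Z" using line k by auto
    ultimately have "A = 0" using R k by simp
    have "?Q (Re y) (Im y) 1 = 0" for y
    proof -
      \<comment> \<open>The inverse of the linear map, applied to \<open>(Re y, Im y, 1)\<close>.\<close>
      define T where "T = reciprocal_power y"
      define X where "X = (Re (y - Z) / k\<^sup>2 - Re b * T) / R"
      define Y where "Y = (Im (y - Z) / k\<^sup>2 - Im b * T) / R"
      have RX: "R * X = Re (y - Z) / k\<^sup>2 - Re b * T" and RY: "R * Y = Im (y - Z) / k\<^sup>2 - Im b * T"
        using R by (simp_all add: X_def Y_def)
      have "T * (h\<^sup>2 - (norm b)\<^sup>2) = 1 - (2 / k\<^sup>2) * (b \<bullet> (y - Z))"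
        using hb by (simp add: T_def reciprocal_power_def)
      moreover have hom: "\<tau> X Y T = 2 * Re b * (R * X) + 2 * Im b * (R * Y) + mean_power * T"
        by (simp add: \<tau>_def)
      then have "\<tau> X Y T = (2 / k\<^sup>2) * (b \<bullet> (y - Z)) + T * (h\<^sup>2 - (norm b)\<^sup>2)"
      proof -
        have "(2 / k\<^sup>2) * (b \<bullet> (y - Z))
            = 2 * Re b * (Re (y - Z) / k\<^sup>2) + 2 * Im b * (Im (y - Z) / k\<^sup>2)"
          by (simp add: inner_complex_def add_divide_distrib distrib_left)
        with hom show ?thesis
          unfolding RX RY mean_power_def cmod_power2 by (simp add: power2_eq_square algebra_simps)
      qed
      ultimately have \<tau>1: "\<tau> X Y T = 1" by simp
      have "\<xi> X Y T = Re y" "\<eta> X Y T = Im y"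
        unfolding \<xi>_def \<eta>_def \<tau>1 RX RY using k by simp_all
      then show ?thesis using G[of X Y T] G_eq[of X Y T] \<tau>1 \<open>A = 0\<close> by simp
    qed
    then have "?Q (y * 1) (y * 0) 1 = 0" for y
      by (metis complex.sel(1) complex.sel(2))
    then show False
      using quadratic_form_vanishing_on_line_degenerate[of p q r' u v w 0 1 0 0] det by simp
  qed
qed

text \<open>The power is largest in the direction \<open>Arg b\<close> and does not increase on either side of it as far
  as the opposite direction, so it stays positive on the way from \<open>s\<close> to \<open>Arg b\<close>.\<close>

lemma connected_component_positive:
  assumes "circle_power s > 0"
  shows "connected_component E (image_center (Arg b)) (image_center s)"
proof -
  have inner_b: "b \<bullet> cis t = norm b * cos (t - Arg b)" for t
  proof -
    have "Re b = norm b * cos (Arg b)" "Im b = norm b * sin (Arg b)"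
      using rcis_cmod_Arg[of b] by (metis Re_rcis, metis Im_rcis)
    then show ?thesis by (simp add: inner_complex_def cos_diff algebra_simps)
  qed
  \<comment> \<open>Shift \<open>s\<close> by full turns to within half a turn of \<open>Arg b\<close>.\<close>
  obtain n :: int where n: "\<bar>s - Arg b - of_int n * (2 * pi)\<bar> \<le> pi"
  proof -
    define m where "m = \<lfloor>(s - Arg b + pi) / (2 * pi)\<rfloor>"
    have "\<bar>s - Arg b - of_int m * (2 * pi)\<bar> \<le> pi"
      using floor_divide_lower [of "2*pi" "s - Arg b + pi"] floor_divide_upper [of "2*pi" "s - Arg b + pi"]
      by (auto simp: m_def abs_if algebra_simps)
    then show thesis by (rule that)
  qed
  define s' where "s' = s - of_int n * (2 * pi)"
  have "cis s' = cis s"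
    using cos_int_2pin[of n] sin_int_2pin[of n]
    by (simp add: s'_def complex_eq_iff cos_diff sin_diff mult.commute)
  then have same: "image_center s' = image_center s" "circle_power s' = circle_power s"
    by (simp_all add: image_center_def circle_power_def position_def)
  have s': "\<bar>s' - Arg b\<bar> \<le> pi" using n by (simp add: s'_def algebra_simps)
  let ?I = "closed_segment (Arg b) s'"
  have pos: "circle_power t > 0" if "t \<in> ?I" for t
  proof -
    have "\<bar>t - Arg b\<bar> \<le> \<bar>s' - Arg b\<bar>"
      using that by (auto simp: closed_segment_eq_real_ivl split: if_splits)
    then have "cos \<bar>s' - Arg b\<bar> \<le> cos \<bar>t - Arg b\<bar>"
      using s' by (intro cos_monotone_0_pi_le) auto
    then have "circle_power s' \<le> circle_power t"
      unfolding circle_power_eq inner_b using R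
      by (intro add_left_mono mult_left_mono) (auto simp: cos_abs_real)
    then show ?thesis using assms same by simp
  qed
  have "continuous_on ?I image_center"
  proof -
    have "continuous_on ?I (\<lambda>t. Z + (k\<^sup>2 / ((norm (b + of_real R * cis t))\<^sup>2 - r\<^sup>2)) *\<^sub>R (b + of_real R * cis t))"
      using pos by (intro continuous_intros) (force simp: circle_power_def position_def)
    then show ?thesis by (simp add: image_center_def[abs_def] circle_power_def position_def)
  qed
  then have "connected (image_center ` ?I)"
    by (rule connected_continuous_image) simp
  moreover have "image_center ` ?I \<subseteq> E"
    using conic_is_image_of_circle(2) pos by fastforce
  ultimately show ?thesis
    unfolding connected_component_def same(1)[symmetric] by blast
qed

lemma same_branch:
  assumes "circle_power s > 0" "circle_power t > 0"
  shows "connected_component E (image_center s) (image_center t)"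
  using connected_component_trans[OF connected_component_sym[OF connected_component_positive[OF assms(1)]]
      connected_component_positive[OF assms(2)]] .

text \<open>On a connected part of \<open>E\<close> containing both centers, \<open>reciprocal_power\<close> would have a zero.\<close>

lemma different_branches:
  assumes "circle_power s * circle_power t < 0"
  shows "\<not> connected_component E (image_center s) (image_center t)"
proof
  assume "connected_component E (image_center s) (image_center t)"
  then obtain S where S: "connected S" "S \<subseteq> E" "image_center s \<in> S" "image_center t \<in> S"
    unfolding connected_component_def by blast
  have nz: "circle_power s \<noteq> 0" "circle_power t \<noteq> 0" using assms by auto
  have "connected (reciprocal_power ` S)"
    using S(1) unfolding reciprocal_power_def by (intro connected_continuous_image continuous_intros)
      (use conic_is_image_of_circle(1) h_pos in \<open>auto simp: power2_eq_iff_nonneg\<close>)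
  moreover have "1 / circle_power s \<in> reciprocal_power ` S" "1 / circle_power t \<in> reciprocal_power ` S"
    using S reciprocal_power_image_center[OF conic_is_image_of_circle(1)] nz by (metis imageI)+
  moreover have "1 / circle_power s \<le> 0 \<and> 0 \<le> 1 / circle_power t \<or>
      1 / circle_power t \<le> 0 \<and> 0 \<le> 1 / circle_power s"
    using assms by (auto simp: mult_less_0_iff)
  ultimately have "0 \<in> reciprocal_power ` S"
    by (meson connected_iff_interval)
  then show False using S(2) conic_is_image_of_circle(3) by force
qed

text \<open>The three branches of the definition: a negative power at a neighbor makes the sign in the cosine
  negative, which the supplementary angle undoes; a negative power at the vertex itself makes \<open>y\<close>
  negative, which the minus sign accounts for; otherwise all three powers are positive.\<close>

lemma summand_eq:
  assumes nz: "circle_power (s - 2 * (pi / real N)) \<noteq> 0" "circle_power s \<noteq> 0"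
      "circle_power (s + 2 * (pi / real N)) \<noteq> 0"
  shows "signed_half_angle_tan E (image_center (s - 2 * (pi / real N))) (image_center s)
           (image_center (s + 2 * (pi / real N))) = tan_factor * circle_power s"
proof -
  define s\<^sub>0 s\<^sub>2 where "s\<^sub>0 = s - 2 * (pi / real N)" and "s\<^sub>2 = s + 2 * (pi / real N)"
  let ?\<kappa> = "cos (pi / real N)" and ?\<sigma> = "sin (pi / real N)"
  define y where "y = tan_factor * circle_power s"
  have hb: "h\<^sup>2 - (norm b)\<^sup>2 \<noteq> 0"
    using conic_is_image_of_circle(1) h_pos by (simp add: power2_eq_iff_nonneg)
  have K_pos: "tan_factor > 0" unfolding tan_factor_def using h_pos r_pos hb by simp
  have \<kappa>: "?\<kappa> > 0" using cos_step_ge_half by linarith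
  have "tan_factor\<^sup>2 * (?\<sigma>\<^sup>2 * (h\<^sup>2 - (norm b)\<^sup>2)\<^sup>2) = ?\<kappa>\<^sup>2"
  proof -
    have "?\<sigma> > 0" using r_pos R by (simp add: r_def zero_less_mult_iff)
    then show ?thesis
      using hb R by (simp add: tan_factor_def h_def r_def power_divide power_mult_distrib)
  qed
  then have prod: "tan_factor\<^sup>2 * ((circle_power s\<^sub>0 + circle_power s) * (circle_power s + circle_power s\<^sub>2))
      = 4 * ?\<kappa>\<^sup>2 * (1 + (tan_factor * circle_power s)\<^sup>2)"
    unfolding s\<^sub>0_def s\<^sub>2_def circle_power_product by (simp add: power_mult_distrib algebra_simps)
  have angle: "angle_at (image_center s\<^sub>0) (image_center s) (image_center s\<^sub>2)
      = arccos (sgn (circle_power s\<^sub>0 * circle_power s\<^sub>2) * ((1 - y\<^sup>2) / (1 + y\<^sup>2)))"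
    unfolding image_center_def y_def
  proof (rule angle_of_tangent_polygon[OF r_pos k K_pos \<kappa>])
    show "(dist (position s\<^sub>0) (position s))\<^sup>2 = 4 * r\<^sup>2"
      using dist_consecutive[of s\<^sub>0] by (simp add: s\<^sub>0_def)
    show "(dist (position s) (position s\<^sub>2))\<^sup>2 = 4 * r\<^sup>2"
      using dist_consecutive[of s] by (simp add: s\<^sub>2_def)
    show "(dist (position s\<^sub>0) (position s\<^sub>2))\<^sup>2 = 16 * r\<^sup>2 * ?\<kappa>\<^sup>2"
      unfolding s\<^sub>0_def s\<^sub>2_def by (rule dist_second)
  qed (use nz prod in \<open>auto simp: s\<^sub>0_def s\<^sub>2_def circle_power_def\<close>)
  note nz' = nz[folded s\<^sub>0_def s\<^sub>2_def]
  show ?thesis unfolding s\<^sub>0_def[symmetric] s\<^sub>2_def[symmetric] y_def[symmetric]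
  proof (cases "circle_power s\<^sub>0 * circle_power s\<^sub>2 < 0")
    case True
    have "circle_power s > 0"
      using True nz' consecutive_not_both_negative[of s\<^sub>0] consecutive_not_both_negative[of s]
      by (auto simp: s\<^sub>0_def s\<^sub>2_def mult_less_0_iff)
    then have "y > 0" using K_pos by (simp add: y_def)
    then show "signed_half_angle_tan E (image_center s\<^sub>0) (image_center s) (image_center s\<^sub>2) = y"
    proof -
      have "sgn (circle_power s\<^sub>0 * circle_power s\<^sub>2) = - 1" using True by simp
      then have "angle_at (image_center s\<^sub>0) (image_center s) (image_center s\<^sub>2)
          = arccos (- ((1 - y\<^sup>2) / (1 + y\<^sup>2)))"
        unfolding angle by (simp only: mult_minus1)
      then show ?thesis
        unfolding signed_half_angle_tan_def Let_def
        using different_branches[OF True] \<open>y > 0\<close>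
        by (simp only: tan_half_supplement_arccos if_True not_False_eq_True abs_of_pos)
    qed
  next
    case False
    then have pos: "circle_power s\<^sub>0 > 0" "circle_power s\<^sub>2 > 0"
      using nz' second_neighbours_not_both_negative[of s]
      by (auto simp: s\<^sub>0_def s\<^sub>2_def mult_less_0_iff not_less zero_le_mult_iff)
    have "connected_component E (image_center s\<^sub>0) (image_center s) \<longleftrightarrow> y > 0"
    proof (cases "circle_power s > 0")
      case True
      then show ?thesis using same_branch[OF pos(1) True] K_pos by (simp add: y_def)
    next
      case False
      then have "circle_power s < 0" using nz'(2) by simp
      then show ?thesis
        using different_branches[of s\<^sub>0 s] pos(1) K_pos
        by (simp add: y_def mult_less_0_iff zero_less_mult_iff)
    qed
    moreover have "connected_component E (image_center s\<^sub>0) (image_center s\<^sub>2)"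
      using same_branch pos by blast
    ultimately show "signed_half_angle_tan E (image_center s\<^sub>0) (image_center s) (image_center s\<^sub>2) = y"
      unfolding signed_half_angle_tan_def Let_def angle
      using pos tan_half_arccos[of y] by (auto simp: sgn_1_pos)
  qed
qed

end

theorem theorem1:
  fixes N :: nat and c Z :: complex and R k :: real and E :: "complex set"
  assumes "N \<ge> 3" and "R > 0" and "k > 0"
    and "nondegenerate_conic E"
    and "\<forall>P \<in> steiner_soddy_family N c R Z k. \<forall>i. P i \<in> E"
  shows "\<exists>S. \<forall>P \<in> steiner_soddy_family N c R Z k.
           (\<Sum>i = 1..N. signed_half_angle_tan E (P (i - 1)) (P i) (P (i + 1))) = S"
proof -
  interpret inscribed_steiner_porism N c Z R k E
    using assms by unfold_locales auto
  show ?thesis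
  proof (intro exI ballI)
    fix P assume "P \<in> steiner_soddy_family N c R Z k"
    then obtain t where t: "\<And>i. circle_power (t + 2 * pi * real i / real N) \<noteq> 0"
      and P: "\<And>i. P i = image_center (t + 2 * pi * real i / real N)"
      unfolding family_iff by blast
    have "signed_half_angle_tan E (P (i - 1)) (P i) (P (i + 1))
        = tan_factor * circle_power (t + 2 * pi * real i / real N)" if "i \<in> {1..N}" for i
    proof -
      have prev: "t + 2 * pi * real (i - 1) / real N = t + 2 * pi * real i / real N - 2 * (pi / real N)"
        using that by (simp add: of_nat_diff field_simps)
      have succ: "t + 2 * pi * real (i + 1) / real N = t + 2 * pi * real i / real N + 2 * (pi / real N)"
        by (simp add: add_divide_distrib distrib_left)
      show ?thesis
        unfolding P prev succ
        by (rule summand_eq) (use t[of "i - 1"] t[of i] t[of "i + 1"] in \<open>simp_all only: prev succ not_False_eq_True\<close>)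
    qed
    then have "(\<Sum>i = 1..N. signed_half_angle_tan E (P (i - 1)) (P i) (P (i + 1)))
        = (\<Sum>i = 1..N. tan_factor * circle_power (t + 2 * pi * real i / real N))"
      by (rule sum.cong[OF refl])
    also have "\<dots> = tan_factor * (real N * mean_power)"
      unfolding sum_distrib_left[symmetric] sum_circle_power ..
    finally show "(\<Sum>i = 1..N. signed_half_angle_tan E (P (i - 1)) (P i) (P (i + 1)))
        = tan_factor * (real N * mean_power)" .
  qed
qed

end
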